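(* Let $g(\cdot)$ be a sub-Riemannian geodesic in $G$ starting at $g_0=\mathrm{Id}$, and let $g'(\cdot)=\pi\circ g(\cdot)$ be its projection to $M$. Let $$\hat t=\sup\{t>0\mid B_t(h_1)\cap B_t(h_2)=\emptyset\ \ \forall\, h_1\ne h_2\in H\}.$$ Then the following bounds hold: (1) $t_{\mathrm{cut}}(g'(\cdot))\le t_{\mathrm{cut}}(g(\cdot))$. (2) If $t_{\mathrm{cut}}(g(\cdot))\ge\hat t$, then $\hat t\le t_{\mathrm{cut}}(g'(\cdot))\le t_{\mathrm{cut}}(g(\cdot))$. (3) If $t_{\mathrm{cut}}(g(\cdot))<\hat t$, then $t_{\mathrm{cut}}(g'(\cdot))=t_{\mathrm{cut}}(g(\cdot))$.
   Context: $G$ is the 3D Heisenberg group of real unipotent upper triangular matrices $\begin{pmatrix}1&a&c\\0&1&b\\0&0&1\end{pmatrix}$, with coordinates $(a,b,c)$ and product $(a,b,c)\cdot(\bar a,\bar b,\bar c)=(a+\bar a,\,b+\bar b,\,c+\bar c+a\bar b)$. $H\subset G$ is the discrete subgroup of elements with $a,b,c\in\mathbb Z$, $M=H\backslash G=\{Hg\mid g\in G\}$ is the compact Heisenberg nil-manifold, and $\pi:G\to M$, $g\mapsto Hg$. The left-invariant fields $X_1=\partial_a$, $X_2=\partial_b+a\,\partial_c$ on $G$ project to fields $X_1',X_2'$ on $M$. $d$ (resp. $d'$) is the sub-Riemannian distance on $G$ (resp. $M$) with orthonormal frame $X_1,X_2$ (resp. $X_1',X_2'$): the infimum of the lengths $\int_0^{t_1}(u_1^2+u_2^2)^{1/2}dt$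 over horizontal curves joining the two points, i.e. Lipschitz curves tangent a.e. to $u_1X_1+u_2X_2$ (resp. $u_1X_1'+u_2X_2'$). $B_t(g)\subset G$ is the closed $d$-ball of radius $t$ centered at $g$. A length minimizer is a horizontal curve whose length equals the distance between its endpoints; a geodesic is a horizontal curve whose sufficiently short arcs are length minimizers. Geodesics are parametrized by arclength on $[0,\infty)$, and $t_{\mathrm{cut}}(q(\cdot))=\sup\{\tau>0\mid q|_{[0,\tau]}\text{ is a length minimizer}\}\in(0,+\infty]$. *)

theory Defs
  imports "HOL-Analysis.Analysis" "HOL-Algebra.Coset"
begin

section \<open>The Heisenberg group, its integer subgroup and the nil-manifold\<close>

text \<open>A point \<open>(a, b, c)\<close> stands for the unipotent matrix with rows
  \<open>1 a c\<close>, \<open>0 1 b\<close>, \<open>0 0 1\<close>; see \<open>heis_matrix_mult\<close> below.\<close>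

type_synonym heis_point = "real \<times> real \<times> real"

definition heis :: "heis_point monoid" where
  "heis = \<lparr>carrier = UNIV,
           monoid.mult = (\<lambda>(a, b, c) (a', b', c'). (a + a', b + b', c + c' + a * b')),
           one = (0, 0, 0)\<rparr>"

definition heis_int :: "heis_point set" where
  "heis_int = {(a, b, c). a \<in> \<int> \<and> b \<in> \<int> \<and> c \<in> \<int>}"

text \<open>Points of \<open>M = H\G\<close> are the cosets \<open>Hg\<close>, which HOL-Algebra calls right cosets.\<close>

definition nil_proj :: "heis_point \<Rightarrow> heis_point set" where
  "nil_proj g = heis_int #>\<^bsub>heis\<^esub> g"

definition nil_manifold :: "heis_point set set" where
  "nil_manifold = rcosets\<^bsub>heis\<^esub> heis_int"

section \<open>Horizontal curves\<close>

definition X1 :: "heis_point \<Rightarrow> heis_point" where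
  "X1 = (\<lambda>(a, b, c). (1, 0, 0))"

definition X2 :: "heis_point \<Rightarrow> heis_point" where
  "X2 = (\<lambda>(a, b, c). (0, 1, a))"

text \<open>The controls \<open>u1\<close>, \<open>u2\<close> are determined almost everywhere by the curve, because
  \<open>X1\<close> and \<open>X2\<close> are linearly independent; being derivatives of Lipschitz functions they are
  automatically measurable and essentially bounded. Lipschitz continuity is meant in the
  coordinates \<open>(a, b, c)\<close>, which for curves on compact intervals does not depend on the
  choice of coordinates.\<close>

definition horizontal_on ::
    "real set \<Rightarrow> (real \<Rightarrow> heis_point) \<Rightarrow> (real \<Rightarrow> real) \<Rightarrow> (real \<Rightarrow> real) \<Rightarrow> bool" where
  "horizontal_on I q u1 u2 \<longleftrightarrow>
     (\<exists>L. L-lipschitz_on I q) \<and>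
     (AE t in lebesgue. t \<in> I \<longrightarrow>
        (q has_vector_derivative (u1 t *\<^sub>R X1 (q t) + u2 t *\<^sub>R X2 (q t))) (at t within I))"

definition horizontal_G ::
    "real \<Rightarrow> real \<Rightarrow> (real \<Rightarrow> heis_point) \<Rightarrow> (real \<Rightarrow> real) \<Rightarrow> (real \<Rightarrow> real) \<Rightarrow> bool" where
  "horizontal_G s t q u1 u2 \<longleftrightarrow> horizontal_on {s..t} q u1 u2"

text \<open>The charts of \<open>M\<close> are the inverses of the restrictions of the projection to open sets
  \<open>U\<close> on which it is injective. In such a chart the projected fields \<open>X1'\<close>, \<open>X2'\<close> have the
  coordinate expressions \<open>X1\<close>, \<open>X2\<close>. Two charts differ locally by a left translation by an
  element of \<open>H\<close>, which preserves \<open>X1\<close> and \<open>X2\<close>, so the condition does not depend on the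
  chart chosen around each point of the curve.\<close>

definition horizontal_M ::
    "real \<Rightarrow> real \<Rightarrow> (real \<Rightarrow> heis_point set) \<Rightarrow> (real \<Rightarrow> real) \<Rightarrow> (real \<Rightarrow> real) \<Rightarrow> bool" where
  "horizontal_M s t q u1 u2 \<longleftrightarrow>
     (\<forall>r\<in>{s..t}. \<exists>U e. open U \<and> inj_on nil_proj U \<and> 0 < e \<and>
        (\<forall>x\<in>{s..t} \<inter> cball r e. q x \<in> nil_proj ` U) \<and>
        horizontal_on ({s..t} \<inter> cball r e) (\<lambda>x. the_inv_into U nil_proj (q x)) u1 u2)"

section \<open>Length, distance, minimizers, geodesics, cut time\<close>

text \<open>These notions are the same on \<open>G\<close> and on \<open>M\<close>; the parameter \<open>hor\<close> is the relation
  \<open>horizontal_G\<close> or \<open>horizontal_M\<close>.\<close>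

type_synonym 'p horizontality =
  "real \<Rightarrow> real \<Rightarrow> (real \<Rightarrow> 'p) \<Rightarrow> (real \<Rightarrow> real) \<Rightarrow> (real \<Rightarrow> real) \<Rightarrow> bool"

definition sr_length :: "real \<Rightarrow> real \<Rightarrow> (real \<Rightarrow> real) \<Rightarrow> (real \<Rightarrow> real) \<Rightarrow> real" where
  "sr_length s t u1 u2 = integral {s..t} (\<lambda>x. sqrt ((u1 x)\<^sup>2 + (u2 x)\<^sup>2))"

text \<open>Any two points of \<open>G\<close>, and hence any two points of \<open>M\<close>, are joined by a horizontal
  curve, so the infimum is over a nonempty set of nonnegative reals.\<close>

definition sr_dist :: "'p horizontality \<Rightarrow> 'p \<Rightarrow> 'p \<Rightarrow> real" where
  "sr_dist hor x y =
     Inf {sr_length 0 t u1 u2 | t q u1 u2. 0 < t \<and> hor 0 t q u1 u2 \<and> q 0 = x \<and> q t = y}"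

definition length_minimizer :: "'p horizontality \<Rightarrow> real \<Rightarrow> real \<Rightarrow> (real \<Rightarrow> 'p) \<Rightarrow> bool" where
  "length_minimizer hor s t q \<longleftrightarrow>
     (\<exists>u1 u2. hor s t q u1 u2 \<and> sr_length s t u1 u2 = sr_dist hor (q s) (q t))"

text \<open>Geodesics are curves on \<open>[0, \<infinity>)\<close>; the values of \<open>q\<close> at negative times are irrelevant.
  How short an arc must be in order to minimize may depend on its position on the curve.\<close>

definition arclength_geodesic :: "'p horizontality \<Rightarrow> (real \<Rightarrow> 'p) \<Rightarrow> bool" where
  "arclength_geodesic hor q \<longleftrightarrow>
     (\<exists>u1 u2. (\<forall>T>0. hor 0 T q u1 u2) \<and>
        (AE t in lebesgue. 0 \<le> t \<longrightarrow> sqrt ((u1 t)\<^sup>2 + (u2 t)\<^sup>2) = 1)) \<and>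
     (\<forall>t\<ge>0. \<exists>e>0. \<forall>s1 s2. 0 \<le> s1 \<and> s1 < s2 \<and> s1 \<in> ball t e \<and> s2 \<in> ball t e \<longrightarrow>
        length_minimizer hor s1 s2 q)"

text \<open>The cut time may be infinite, hence the extended reals. Short initial arcs of a geodesic
  minimize, so the supremum is then over a nonempty set.\<close>

definition t_cut :: "'p horizontality \<Rightarrow> (real \<Rightarrow> 'p) \<Rightarrow> ereal" where
  "t_cut hor q = Sup (ereal ` {\<tau>. 0 < \<tau> \<and> length_minimizer hor 0 \<tau> q})"

definition sr_ball :: "real \<Rightarrow> heis_point \<Rightarrow> heis_point set" where
  "sr_ball t g = {x. sr_dist horizontal_G g x \<le> t}"

definition t_hat :: ereal where
  "t_hat = Sup (ereal ` {t. 0 < t \<and>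
     (\<forall>h1\<in>heis_int. \<forall>h2\<in>heis_int. h1 \<noteq> h2 \<longrightarrow> sr_ball t h1 \<inter> sr_ball t h2 = {})})"

section \<open>Consistency of the coordinate description\<close>

definition heis_matrix :: "heis_point \<Rightarrow> real^3^3" where
  "heis_matrix = (\<lambda>(a, b, c). vector [vector [1, a, c], vector [0, 1, b], vector [0, 0, 1]])"

lemma heis_matrix_mult: "heis_matrix (g \<otimes>\<^bsub>heis\<^esub> k) = heis_matrix g ** heis_matrix k"
  by (cases g; cases k)
     (simp add: heis_def heis_matrix_def matrix_matrix_mult_def vec_eq_iff forall_3 sum_3 vector_3
        algebra_simps)

lemma group_heis: "group heis"
proof (rule groupI)
  fix x assume "x \<in> carrier heis"
  obtain a b c where "x = (a, b, c)" by (cases x)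
  then have "(- a, - b, a * b - c) \<otimes>\<^bsub>heis\<^esub> x = \<one>\<^bsub>heis\<^esub>"
    by (simp add: heis_def)
  then show "\<exists>y\<in>carrier heis. y \<otimes>\<^bsub>heis\<^esub> x = \<one>\<^bsub>heis\<^esub>"
    by (intro bexI[of _ "(- a, - b, a * b - c)"]) (simp_all add: heis_def)
qed (auto simp: heis_def algebra_simps)

lemma nil_proj_image: "range nil_proj = nil_manifold"
  by (auto simp: nil_proj_def nil_manifold_def RCOSETS_def heis_def)

lemma subgroup_heis_int: "subgroup heis_int heis"
proof (rule group.subgroupI[OF group_heis])
  fix x assume x: "x \<in> heis_int"
  obtain a b c where abc: "x = (a, b, c)" by (cases x)
  have "inv\<^bsub>heis\<^esub> x = (- a, - b, a * b - c)"
    by (rule group.inv_equality[OF group_heis]) (simp_all add: abc heis_def)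
  then show "inv\<^bsub>heis\<^esub> x \<in> heis_int"
    using x abc by (auto simp: heis_int_def)
qed (auto simp: heis_def heis_int_def intro: exI[of _ 0])

end

theory Submission
  imports Defs
begin

text \<open>The projection from the Heisenberg group to the nil-manifold is a covering whose deck
  transformations, the left translations by integer points, preserve the horizontal frame. Hence
  horizontal curves in the group project to horizontal curves with the same controls
  (\<open>horizontal_M_projection\<close>), horizontal curves in the nil-manifold lift to horizontal curves with
  the same controls and a prescribed starting point (\<open>horizontal_M_lift\<close>), and lifts are unique
  (\<open>nil_proj_lift_unique\<close>). All of these operations preserve length.

  Since projecting does not change length, distances do not increase under the projection. So if
  the projection of \<open>g\<close> minimizes on an interval, then so does \<open>g\<close>
  (\<open>length_minimizer_G_of_projection\<close>), which bounds the cut time downstairs by the one upstairs.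

  Conversely, let \<open>g\<close> minimize on \<open>[0, t]\<close> with \<open>t < t_hat\<close>. A curve downstairs that is shorter
  than the projection of \<open>g\<close> lifts to a curve from the identity to \<open>h \<otimes> g t\<close> for some integer point
  \<open>h\<close>, and \<open>h\<close> is not the identity because \<open>g\<close> minimizes. The endpoint is at distance at most \<open>t\<close>
  both from the identity and from \<open>h\<close>, which contradicts the disjointness of the balls of some
  radius larger than \<open>t\<close> around integer points (\<open>length_minimizer_projection\<close>). So below \<open>t_hat\<close>
  the curve and its projection minimize on the same initial intervals.

  If \<open>g\<close> loses optimality before \<open>t_hat\<close>, all its minimizing intervals are of this kind and the cut
  times agree. If not, \<open>g\<close> minimizes on every interval shorter than \<open>t_hat\<close>, because initial arcs of
  minimizers are minimizers (\<open>length_minimizer_G_restrict\<close>); hence so does the projection, and its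
  cut time is at least \<open>t_hat\<close>.\<close>

section \<open>Left translations and the fibres of the projection\<close>

lemma heis_mult: "(a, b, c) \<otimes>\<^bsub>heis\<^esub> (a', b', c') = (a + a', b + b', c + c' + a * b')"
  by (simp add: heis_def)

lemma heis_one: "\<one>\<^bsub>heis\<^esub> = (0, 0, 0)"
  by (simp add: heis_def)

lemma heis_mult_one [simp]: "x \<otimes>\<^bsub>heis\<^esub> \<one>\<^bsub>heis\<^esub> = x" "\<one>\<^bsub>heis\<^esub> \<otimes>\<^bsub>heis\<^esub> x = x"
  by (cases x; simp add: heis_one heis_mult)+

lemma heis_one_int: "\<one>\<^bsub>heis\<^esub> \<in> heis_int"
  by (simp add: heis_one heis_int_def)

lemma nil_proj_eq_iff: "nil_proj x = nil_proj y \<longleftrightarrow> (\<exists>h\<in>heis_int. y = h \<otimes>\<^bsub>heis\<^esub> x)"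
proof
  assume "nil_proj x = nil_proj y"
  moreover have "y \<in> nil_proj y"
    using heis_one_int by (force simp: nil_proj_def r_coset_def)
  ultimately show "\<exists>h\<in>heis_int. y = h \<otimes>\<^bsub>heis\<^esub> x"
    by (auto simp: nil_proj_def r_coset_def)
next
  interpret heis: group heis by (rule group_heis)
  assume "\<exists>h\<in>heis_int. y = h \<otimes>\<^bsub>heis\<^esub> x"
  then have "y \<in> heis_int #>\<^bsub>heis\<^esub> x"
    by (auto simp: r_coset_def)
  then show "nil_proj x = nil_proj y"
    unfolding nil_proj_def
    by (intro heis.repr_independence subgroup_heis_int) (auto simp: heis_def)
qed

lemma nil_proj_translate: "h \<in> heis_int \<Longrightarrow> nil_proj (h \<otimes>\<^bsub>heis\<^esub> x) = nil_proj x"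
  using nil_proj_eq_iff by metis

text \<open>Two distinct points of a fibre differ by a nonzero integer in some coordinate: in the third
  one when the first two agree.\<close>

lemma inj_on_nil_proj_ball: "inj_on nil_proj (ball x (1/2))"
proof (rule inj_onI)
  fix y z assume yz: "y \<in> ball x (1/2)" "z \<in> ball x (1/2)" "nil_proj y = nil_proj z"
  obtain h where h: "h \<in> heis_int" "z = h \<otimes>\<^bsub>heis\<^esub> y"
    using yz(3) by (auto simp: nil_proj_eq_iff)
  obtain a b c k l m where y: "y = (a, b, c)" and hk: "h = (k, l, m)"
    by (cases y, cases h) auto
  have z: "z = (k + a, l + b, m + c + k * b)"
    using h y hk by (simp add: heis_mult)
  have d: "dist y z < 1"
    using yz(1,2) dist_triangle_half_r[of x y 1 z] by (simp add: dist_commute)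
  have small: "dist (fst y) (fst z) < 1" "dist (fst (snd y)) (fst (snd z)) < 1"
      "dist (snd (snd y)) (snd (snd z)) < 1"
    using d dist_fst_le[of y z] dist_snd_le[of y z] dist_fst_le[of "snd y" "snd z"]
      dist_snd_le[of "snd y" "snd z"] by linarith+
  have ints: "k \<in> \<int>" "l \<in> \<int>" "m \<in> \<int>"
    using h hk by (auto simp: heis_int_def)
  have "k = 0" "l = 0"
    using small ints by (auto simp: y z dist_real_def elim!: Ints_cases)
  moreover from this have "m = 0"
    using small ints by (auto simp: y z dist_real_def elim!: Ints_cases)
  ultimately show "y = z"
    by (simp add: y z)
qed

text \<open>The linear part of the left translation by \<open>h\<close>, which is an affine map.\<close>

definition translation_deriv :: "heis_point \<Rightarrow> heis_point \<Rightarrow> heis_point" where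
  "translation_deriv h v = v + (0, 0, fst h * fst (snd v))"

lemma bounded_linear_translation_deriv: "bounded_linear (translation_deriv h)"
proof -
  have "linear (translation_deriv h)"
    by (rule linearI) (auto simp: translation_deriv_def algebra_simps)
  then show ?thesis
    by (simp add: linear_conv_bounded_linear)
qed

lemma heis_mult_affine: "h \<otimes>\<^bsub>heis\<^esub> x = h + translation_deriv h x"
  by (cases h; cases x) (simp add: heis_mult translation_deriv_def)

text \<open>The frame is left-invariant, so translating a horizontal curve keeps its controls.\<close>

lemma translation_deriv_frame:
  "translation_deriv h (\<alpha> *\<^sub>R X1 x + \<beta> *\<^sub>R X2 x) =
     \<alpha> *\<^sub>R X1 (h \<otimes>\<^bsub>heis\<^esub> x) + \<beta> *\<^sub>R X2 (h \<otimes>\<^bsub>heis\<^esub> x)"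
  by (cases h; cases x) (simp add: heis_mult translation_deriv_def X1_def X2_def algebra_simps)

section \<open>Operations on horizontal curves\<close>

lemma horizontal_on_iff_negligible:
  "horizontal_on I q u1 u2 \<longleftrightarrow>
     (\<exists>L. L-lipschitz_on I q) \<and>
     (\<exists>N. negligible N \<and> (\<forall>t\<in>I - N.
        (q has_vector_derivative (u1 t *\<^sub>R X1 (q t) + u2 t *\<^sub>R X2 (q t))) (at t within I)))"
  unfolding horizontal_on_def eventually_ae_filter_negligible by blast

lemma horizontal_on_continuous_on: "horizontal_on I q u1 u2 \<Longrightarrow> continuous_on I q"
  by (auto simp: horizontal_on_def intro: lipschitz_on_continuous_on)

lemma horizontal_on_subset:
  assumes "horizontal_on I q u1 u2" and "J \<subseteq> I"
  shows "horizontal_on J q u1 u2"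
proof -
  obtain L N where "L-lipschitz_on I q" and "negligible N" and
    "\<And>t. t \<in> I - N \<Longrightarrow>
        (q has_vector_derivative (u1 t *\<^sub>R X1 (q t) + u2 t *\<^sub>R X2 (q t))) (at t within I)"
    using assms(1) unfolding horizontal_on_iff_negligible by blast
  then show ?thesis
    unfolding horizontal_on_iff_negligible using assms(2)
    by (meson DiffD1 DiffD2 DiffI has_vector_derivative_within_subset lipschitz_on_subset subsetD)
qed

lemma horizontal_on_cong:
  assumes "horizontal_on I q u1 u2" and "\<And>x. x \<in> I \<Longrightarrow> p x = q x"
  shows "horizontal_on I p u1 u2"
proof -
  obtain L N where L: "L-lipschitz_on I q" and N: "negligible N"
    "\<And>t. t \<in> I - N \<Longrightarrow>
        (q has_vector_derivative (u1 t *\<^sub>R X1 (q t) + u2 t *\<^sub>R X2 (q t))) (at t within I)"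
    using assms(1) unfolding horizontal_on_iff_negligible by blast
  have "L-lipschitz_on I p"
    using L assms(2) by (auto intro: lipschitz_on_transform)
  moreover have "(p has_vector_derivative (u1 t *\<^sub>R X1 (p t) + u2 t *\<^sub>R X2 (p t))) (at t within I)"
    if "t \<in> I - N" for t
    using has_vector_derivative_transform[of t I p q] N(2)[OF that] that assms(2) by auto
  ultimately show ?thesis
    unfolding horizontal_on_iff_negligible using N(1) by blast
qed

lemma horizontal_on_translate:
  assumes "horizontal_on I q u1 u2"
  shows "horizontal_on I (\<lambda>x. h \<otimes>\<^bsub>heis\<^esub> q x) u1 u2"
proof -
  obtain L N where L: "L-lipschitz_on I q" and N: "negligible N"
    "\<And>t. t \<in> I - N \<Longrightarrow>
        (q has_vector_derivative (u1 t *\<^sub>R X1 (q t) + u2 t *\<^sub>R X2 (q t))) (at t within I)"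
    using assms unfolding horizontal_on_iff_negligible by blast
  obtain B where "B-lipschitz_on (q ` I) (translation_deriv h)"
    using bounded_linear.lipschitz_boundE[OF bounded_linear_translation_deriv] by blast
  from lipschitz_on_compose2[OF L this]
  have "(0 + B * L)-lipschitz_on I (\<lambda>x. h \<otimes>\<^bsub>heis\<^esub> q x)"
    unfolding heis_mult_affine by (intro lipschitz_intros)
  moreover have "((\<lambda>x. h \<otimes>\<^bsub>heis\<^esub> q x) has_vector_derivative
      (u1 t *\<^sub>R X1 (h \<otimes>\<^bsub>heis\<^esub> q t) + u2 t *\<^sub>R X2 (h \<otimes>\<^bsub>heis\<^esub> q t))) (at t within I)"
    if "t \<in> I - N" for t
  proof -
    have "((\<lambda>x. translation_deriv h (q x)) has_vector_derivative
        translation_deriv h (u1 t *\<^sub>R X1 (q t) + u2 t *\<^sub>R X2 (q t))) (at t within I)"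
      by (rule bounded_linear.has_vector_derivative[OF bounded_linear_translation_deriv N(2)[OF that]])
    from has_vector_derivative_add[OF has_vector_derivative_const[of h] this] show ?thesis
      by (simp add: heis_mult_affine[symmetric] translation_deriv_frame)
  qed
  ultimately show ?thesis
    unfolding horizontal_on_iff_negligible using N(1) by blast
qed

lemma horizontal_on_shift:
  assumes "horizontal_on {s..t} q u1 u2"
  shows "horizontal_on {s - c..t - c} (\<lambda>x. q (x + c)) (\<lambda>x. u1 (x + c)) (\<lambda>x. u2 (x + c))"
proof -
  obtain L N where L: "L-lipschitz_on {s..t} q" and N: "negligible N"
    "\<And>x. x \<in> {s..t} - N \<Longrightarrow>
        (q has_vector_derivative (u1 x *\<^sub>R X1 (q x) + u2 x *\<^sub>R X2 (q x))) (at x within {s..t})"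
    using assms unfolding horizontal_on_iff_negligible by blast
  have im: "(\<lambda>x. x + c) ` {s - c..t - c} = {s..t}"
    by simp
  have "L-lipschitz_on {s - c..t - c} (\<lambda>x. q (x + c))"
  proof (rule lipschitz_onI)
    fix x y assume "x \<in> {s - c..t - c}" "y \<in> {s - c..t - c}"
    then show "dist (q (x + c)) (q (y + c)) \<le> L * dist x y"
      using lipschitz_onD[OF L, of "x + c" "y + c"] by (auto simp: dist_real_def)
  qed (rule lipschitz_on_nonneg[OF L])
  moreover have "negligible ((+) (- c) ` N)"
    using N(1) by (rule negligible_translation)
  moreover have "((\<lambda>x. q (x + c)) has_vector_derivative
      (u1 (x + c) *\<^sub>R X1 (q (x + c)) + u2 (x + c) *\<^sub>R X2 (q (x + c)))) (at x within {s - c..t - c})"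
    if x: "x \<in> {s - c..t - c} - (+) (- c) ` N" for x
  proof -
    have "x + c \<in> {s..t} - N"
      using x by (force simp: image_iff)
    then have "(q has_vector_derivative (u1 (x + c) *\<^sub>R X1 (q (x + c)) + u2 (x + c) *\<^sub>R X2 (q (x + c))))
        (at (x + c) within (\<lambda>x. x + c) ` {s - c..t - c})"
      unfolding im by (rule N(2))
    moreover have "((\<lambda>x. x + c) has_vector_derivative 1) (at x within {s - c..t - c})"
      by (auto intro!: derivative_eq_intros simp: has_vector_derivative_def)
    ultimately show ?thesis
      using vector_diff_chain_within[of "\<lambda>x. x + c" 1 x "{s - c..t - c}" q] by (simp add: o_def)
  qed
  ultimately show ?thesis
    unfolding horizontal_on_iff_negligible by blast
qed

text \<open>At the junction the one-sided derivatives may differ. This single point, like the two ends, is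
  negligible; at every other point the derivative is that of one of the two pieces.\<close>

lemma horizontal_on_glue:
  fixes a b c :: real
  assumes "horizontal_on {a..b} q u1 u2" and "horizontal_on {b..c} p v1 v2" and "q b = p b"
  shows "horizontal_on {a..c} (\<lambda>x. if x \<le> b then q x else p x)
           (\<lambda>x. if x \<le> b then u1 x else v1 x) (\<lambda>x. if x \<le> b then u2 x else v2 x)"
    (is "horizontal_on _ ?r ?w1 ?w2")
proof -
  obtain L N where L: "L-lipschitz_on {a..b} q" and N: "negligible N"
    "\<And>x. x \<in> {a..b} - N \<Longrightarrow>
        (q has_vector_derivative (u1 x *\<^sub>R X1 (q x) + u2 x *\<^sub>R X2 (q x))) (at x within {a..b})"
    using assms(1) unfolding horizontal_on_iff_negligible by blast
  obtain K N' where K: "K-lipschitz_on {b..c} p" and N': "negligible N'"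
    "\<And>x. x \<in> {b..c} - N' \<Longrightarrow>
        (p has_vector_derivative (v1 x *\<^sub>R X1 (p x) + v2 x *\<^sub>R X2 (p x))) (at x within {b..c})"
    using assms(2) unfolding horizontal_on_iff_negligible by blast
  have "(max L K)-lipschitz_on {a..c} ?r"
    using L K assms(3) by (intro lipschitz_on_concat) (auto elim: lipschitz_on_mono)
  moreover have "negligible (N \<union> N' \<union> {a, b, c})"
    using N(1) N'(1) by (intro negligible_Un) auto
  moreover have "(?r has_vector_derivative (?w1 x *\<^sub>R X1 (?r x) + ?w2 x *\<^sub>R X2 (?r x)))
      (at x within {a..c})" if x: "x \<in> {a..c} - (N \<union> N' \<union> {a, b, c})" for x
  proof (cases "x < b")
    case True
    then have "(q has_vector_derivative (u1 x *\<^sub>R X1 (q x) + u2 x *\<^sub>R X2 (q x))) (at x)"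
      using N(2)[of x] x at_within_Icc_at[of a x b] by auto
    then have "(?r has_vector_derivative (u1 x *\<^sub>R X1 (q x) + u2 x *\<^sub>R X2 (q x))) (at x)"
      by (rule has_vector_derivative_transform_within_open[where S = "{..<b}"]) (use True in auto)
    then show ?thesis
      using True by (auto intro: has_vector_derivative_at_within)
  next
    case False
    with x have "b < x" by auto
    then have "(p has_vector_derivative (v1 x *\<^sub>R X1 (p x) + v2 x *\<^sub>R X2 (p x))) (at x)"
      using N'(2)[of x] x at_within_Icc_at[of b x c] by auto
    then have "(?r has_vector_derivative (v1 x *\<^sub>R X1 (p x) + v2 x *\<^sub>R X2 (p x))) (at x)"
      by (rule has_vector_derivative_transform_within_open[where S = "{b<..}"]) (use \<open>b < x\<close> in auto)
    then show ?thesis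
      using \<open>b < x\<close> by (auto intro: has_vector_derivative_at_within)
  qed
  ultimately show ?thesis
    unfolding horizontal_on_iff_negligible by blast
qed

section \<open>Horizontal lifts\<close>

text \<open>A half-unit ball around a point of \<open>g\<close> is a chart domain, and the lift through it is the
  curve \<open>g\<close> itself, so the controls do not change.\<close>

lemma horizontal_M_projection:
  assumes "horizontal_G s t g u1 u2"
  shows "horizontal_M s t (nil_proj \<circ> g) u1 u2"
  unfolding horizontal_M_def
proof
  fix r assume r: "r \<in> {s..t}"
  let ?U = "ball (g r) (1/2)"
  have g: "horizontal_on {s..t} g u1 u2"
    using assms by (simp add: horizontal_G_def)
  then obtain d where d: "d > 0" "\<And>x. x \<in> {s..t} \<Longrightarrow> dist x r < d \<Longrightarrow> dist (g x) (g r) < 1/2"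
    using horizontal_on_continuous_on[OF g] r unfolding continuous_on_iff
    by (metis half_gt_zero_iff zero_less_one)
  have U: "g x \<in> ?U" if "x \<in> {s..t} \<inter> cball r (d/2)" for x
    using d(2)[of x] d(1) that by (auto simp: dist_commute)
  have "horizontal_on ({s..t} \<inter> cball r (d/2)) g u1 u2"
    using g by (rule horizontal_on_subset) simp
  then have "horizontal_on ({s..t} \<inter> cball r (d/2))
      (\<lambda>x. the_inv_into ?U nil_proj ((nil_proj \<circ> g) x)) u1 u2"
    by (rule horizontal_on_cong) (use U inj_on_nil_proj_ball in \<open>simp add: the_inv_into_f_f\<close>)
  with U d(1) inj_on_nil_proj_ball
  show "\<exists>U e. open U \<and> inj_on nil_proj U \<and> 0 < e \<and>
        (\<forall>x\<in>{s..t} \<inter> cball r e. (nil_proj \<circ> g) x \<in> nil_proj ` U) \<and>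
        horizontal_on ({s..t} \<inter> cball r e)
          (\<lambda>x. the_inv_into U nil_proj ((nil_proj \<circ> g) x)) u1 u2"
    by (intro exI[of _ ?U] exI[of _ "d/2"]) auto
qed

text \<open>Near each parameter a chart provides some lift. A suitable integer translation moves its
  starting point to any prescribed point of the fibre and keeps the controls, so lifts over
  adjacent intervals can be glued, and bisection of the parameter interval gives a lift of the
  whole curve.\<close>

lemma horizontal_M_lift:
  assumes "horizontal_M s t q u1 u2" and "s \<le> t" and "nil_proj z = q s"
  obtains Q where "horizontal_G s t Q u1 u2" and "Q s = z"
    and "\<And>x. x \<in> {s..t} \<Longrightarrow> nil_proj (Q x) = q x"
proof -
  define liftable where "liftable a b \<longleftrightarrow> (s \<le> a \<and> a \<le> b \<and> b \<le> t \<longrightarrow>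
      (\<forall>z. nil_proj z = q a \<longrightarrow> (\<exists>Q. horizontal_on {a..b} Q u1 u2 \<and> Q a = z \<and>
          (\<forall>x\<in>{a..b}. nil_proj (Q x) = q x))))" for a b
  have "liftable s t"
    using assms(2)
  proof (induction rule: Bolzano)
    case (trans a b c)
    show ?case
      unfolding liftable_def
    proof (intro impI allI)
      fix z assume ac: "s \<le> a \<and> a \<le> c \<and> c \<le> t" and z: "nil_proj z = q a"
      obtain P where P: "horizontal_on {a..b} P u1 u2" "P a = z"
        "\<forall>x\<in>{a..b}. nil_proj (P x) = q x"
        using trans ac z unfolding liftable_def by (meson order_trans)
      have "nil_proj (P b) = q b"
        using P(3) trans by simp
      then obtain R where R: "horizontal_on {b..c} R u1 u2" "R b = P b"
        "\<forall>x\<in>{b..c}. nil_proj (R x) = q x"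
        using trans ac unfolding liftable_def by (meson order_trans)
      have "horizontal_on {a..c} (\<lambda>x. if x \<le> b then P x else R x) u1 u2"
        using horizontal_on_glue[OF P(1) R(1)] R(2) by simp
      then show "\<exists>Q. horizontal_on {a..c} Q u1 u2 \<and> Q a = z \<and>
          (\<forall>x\<in>{a..c}. nil_proj (Q x) = q x)"
        using P R trans by (intro exI[of _ "\<lambda>x. if x \<le> b then P x else R x"]) auto
    qed
  next
    case (local r)
    then obtain U e where U: "inj_on nil_proj U" and e: "0 < e"
      and q: "\<forall>x\<in>{s..t} \<inter> cball r e. q x \<in> nil_proj ` U"
      and hor: "horizontal_on ({s..t} \<inter> cball r e) (\<lambda>x. the_inv_into U nil_proj (q x)) u1 u2"
      using assms(1) unfolding horizontal_M_def by (meson atLeastAtMost_iff)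
    define \<sigma> where "\<sigma> x = the_inv_into U nil_proj (q x)" for x
    have \<sigma>: "nil_proj (\<sigma> x) = q x" if "x \<in> {s..t} \<inter> cball r e" for x
      using f_the_inv_into_f[OF U] q that by (simp add: \<sigma>_def)
    have "liftable a b" if ab: "a \<le> r" "r \<le> b" "b - a < e" for a b
      unfolding liftable_def
    proof (intro impI allI)
      fix z assume st: "s \<le> a \<and> a \<le> b \<and> b \<le> t" and z: "nil_proj z = q a"
      have sub: "{a..b} \<subseteq> {s..t} \<inter> cball r e"
        using ab st by (auto simp: dist_real_def)
      have "nil_proj (\<sigma> a) = nil_proj z"
        using \<sigma>[of a] sub st z by auto
      then obtain h where h: "h \<in> heis_int" "z = h \<otimes>\<^bsub>heis\<^esub> \<sigma> a"
        unfolding nil_proj_eq_iff by blast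
      have "horizontal_on {a..b} (\<lambda>x. h \<otimes>\<^bsub>heis\<^esub> \<sigma> x) u1 u2"
        unfolding \<sigma>_def using horizontal_on_subset[OF hor sub] by (rule horizontal_on_translate)
      then show "\<exists>Q. horizontal_on {a..b} Q u1 u2 \<and> Q a = z \<and>
          (\<forall>x\<in>{a..b}. nil_proj (Q x) = q x)"
        using h \<sigma> sub
        by (intro exI[of _ "\<lambda>x. h \<otimes>\<^bsub>heis\<^esub> \<sigma> x"]) (auto simp: nil_proj_translate)
    qed
    then show ?case
      using e by blast
  qed
  then obtain Q where "horizontal_on {s..t} Q u1 u2" "Q s = z" "\<forall>x\<in>{s..t}. nil_proj (Q x) = q x"
    using assms(2,3) unfolding liftable_def by blast
  then show thesis
    using that by (simp add: horizontal_G_def)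
qed

lemma continuous_on_Ints_const:
  fixes f :: "real \<Rightarrow> real"
  assumes "continuous_on {s..t} f" and "\<And>x. x \<in> {s..t} \<Longrightarrow> f x \<in> \<int>" and "x \<in> {s..t}"
  shows "f x = f s"
proof -
  have "f constant_on {s..t}"
  proof (rule continuous_discrete_range_constant[OF connected_Icc assms(1)])
    fix x assume x: "x \<in> {s..t}"
    have "1 \<le> norm (f y - f x)" if "y \<in> {s..t}" "f y \<noteq> f x" for y
      using Ints_nonzero_abs_ge1[of "f y - f x"] assms(2) x that by simp
    then show "\<exists>e>0. \<forall>y. y \<in> {s..t} \<and> f y \<noteq> f x \<longrightarrow> e \<le> norm (f y - f x)"
      by (intro exI[of _ 1]) auto
  qed
  then show ?thesis
    using assms(3) unfolding constant_on_def by auto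
qed

text \<open>Two lifts differ by an element of the discrete subgroup that varies continuously, hence is
  constant, and it is the identity at the start.\<close>

lemma nil_proj_lift_unique:
  fixes P Q :: "real \<Rightarrow> heis_point"
  assumes "continuous_on {s..t} P" and "continuous_on {s..t} Q"
    and "\<And>x. x \<in> {s..t} \<Longrightarrow> nil_proj (P x) = nil_proj (Q x)"
    and "P s = Q s" and "x \<in> {s..t}"
  shows "P x = Q x"
proof -
  define a b c where "a y = fst (Q y) - fst (P y)" and "b y = fst (snd (Q y)) - fst (snd (P y))"
    and "c y = snd (snd (Q y)) - snd (snd (P y))" for y
  have "continuous_on {s..t} a" "continuous_on {s..t} b" "continuous_on {s..t} c"
    unfolding a_def b_def c_def using assms(1,2) by (intro continuous_intros; simp)+
  moreover have H: "a y \<in> \<int> \<and> b y \<in> \<int> \<and> c y - a y * fst (snd (P y)) \<in> \<int>" if "y \<in> {s..t}" for y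
  proof -
    obtain h where h: "h \<in> heis_int" "Q y = h \<otimes>\<^bsub>heis\<^esub> P y"
      using assms(3)[OF \<open>y \<in> {s..t}\<close>] nil_proj_eq_iff by blast
    then show ?thesis
      by (cases "P y"; cases h) (simp add: a_def b_def c_def heis_mult heis_int_def)
  qed
  moreover have "a s = 0" "b s = 0" "c s = 0"
    by (simp_all add: a_def b_def c_def assms(4))
  ultimately have a: "a y = 0" and b: "b y = 0" if "y \<in> {s..t}" for y
    using continuous_on_Ints_const[of s t a y] continuous_on_Ints_const[of s t b y] that by auto
  \<comment> \<open>The third coordinate of the deck transformation is \<open>c - a * fst (snd P)\<close>, so only now is \<open>c\<close>
    known to be integral.\<close>
  with H have "c y \<in> \<int>" if "y \<in> {s..t}" for y
    using that by force
  then have "c x = 0"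
    using continuous_on_Ints_const[of s t c x] \<open>continuous_on {s..t} c\<close> \<open>c s = 0\<close> assms(5) by simp
  with a[OF assms(5)] b[OF assms(5)] show ?thesis
    by (simp add: a_def b_def c_def prod_eq_iff)
qed

text \<open>Controls are only determined almost everywhere, so different controls may witness that \<open>g\<close>
  and its projection are horizontal. Lifting the projection with given controls returns \<open>g\<close> by
  uniqueness, so the same controls serve for both curves.\<close>

lemma horizontal_G_of_projection:
  assumes "continuous_on {s..t} g" and "horizontal_M s t (nil_proj \<circ> g) u1 u2" and "s \<le> t"
  shows "horizontal_G s t g u1 u2"
proof -
  obtain Q where Q: "horizontal_G s t Q u1 u2" "Q s = g s"
    "\<And>x. x \<in> {s..t} \<Longrightarrow> nil_proj (Q x) = (nil_proj \<circ> g) x"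
    using horizontal_M_lift[OF assms(2,3), of "g s"] by auto
  have "g x = Q x" if "x \<in> {s..t}" for x
    using nil_proj_lift_unique[of s t g Q x] assms(1) Q that horizontal_on_continuous_on
    by (auto simp: horizontal_G_def)
  with Q(1) show ?thesis
    unfolding horizontal_G_def by (rule horizontal_on_cong)
qed

section \<open>Length and distance\<close>

text \<open>The additivity of length rests on this. The controls come as arbitrary functions; they are
  identified almost everywhere through the difference quotients of the curve, which are continuous
  and bounded by the Lipschitz constant, so dominated convergence applies to the speeds.\<close>

lemma horizontal_speed_integrable:
  assumes "horizontal_on {s..t} q u1 u2"
  shows "(\<lambda>x. sqrt ((u1 x)\<^sup>2 + (u2 x)\<^sup>2)) integrable_on {s..t}"
proof (cases "s \<le> t")
  case False
  then show ?thesis by (simp add: integrable_on_empty)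
next
  case True
  obtain L N where L: "L-lipschitz_on {s..t} q" and N: "negligible N"
    "\<And>x. x \<in> {s..t} - N \<Longrightarrow>
        (q has_vector_derivative (u1 x *\<^sub>R X1 (q x) + u2 x *\<^sub>R X2 (q x))) (at x within {s..t})"
    using assms unfolding horizontal_on_iff_negligible by blast
  have "0 \<le> L" using L by (rule lipschitz_on_nonneg)
  \<comment> \<open>Extending the curve by its end values makes its difference quotients continuous.\<close>
  define p where "p x = q (max s (min t x))" for x
  have p: "dist (p x) (p y) \<le> L * dist x y" for x y
  proof -
    have "dist (p x) (p y) \<le> L * dist (max s (min t x)) (max s (min t y))"
      unfolding p_def using True by (intro lipschitz_onD[OF L]) auto
    also have "\<dots> \<le> L * dist x y"
      using \<open>0 \<le> L\<close> by (intro mult_left_mono) (auto simp: dist_real_def)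
    finally show ?thesis .
  qed
  define D where "D k x = real (Suc k) *\<^sub>R (p (x + inverse (real (Suc k))) - p x)" for k x
  define v where "v x = u1 x *\<^sub>R X1 (q x) + u2 x *\<^sub>R X2 (q x)" for x
  define hspeed where "hspeed w = sqrt ((fst w)\<^sup>2 + (fst (snd w))\<^sup>2)" for w :: heis_point
  have v: "hspeed (v x) = sqrt ((u1 x)\<^sup>2 + (u2 x)\<^sup>2)" for x
    by (cases "q x") (simp add: v_def hspeed_def X1_def X2_def)
  have hspeed_le: "hspeed w \<le> norm w" for w
    by (cases w) (simp add: hspeed_def norm_prod_def add.assoc)
  have hspeed_cont: "continuous_on UNIV hspeed"
    unfolding hspeed_def by (intro continuous_intros)
  have D_le: "norm (D k x) \<le> L" for k x
  proof -
    have "norm (D k x) = real (Suc k) * dist (p (x + inverse (real (Suc k)))) (p x)"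
      by (simp add: D_def dist_norm)
    also have "\<dots> \<le> real (Suc k) * (L * inverse (real (Suc k)))"
      using p[of "x + inverse (real (Suc k))" x]
      by (intro mult_left_mono) (auto simp: dist_real_def)
    also have "\<dots> = L"
      by simp
    finally show ?thesis .
  qed
  have "L-lipschitz_on UNIV p"
    using p \<open>0 \<le> L\<close> by (auto intro: lipschitz_onI)
  then have p_cont: "continuous_on UNIV p"
    by (rule lipschitz_on_continuous_on)
  have D_cont: "continuous_on {s..t} (D k)" for k
    unfolding D_def
    by (intro continuous_intros continuous_on_compose2[OF p_cont]) auto
  have D_lim: "(\<lambda>k. D k x) \<longlonglongrightarrow> v x" if x: "x \<in> {s..t} - (N \<union> {s, t})" for x
  proof -
    have "(q has_vector_derivative v x) (at x)"
      using N(2)[of x] x at_within_Icc_at[of s x t] by (auto simp: v_def)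
    then have "(p has_vector_derivative v x) (at x)"
      by (rule has_vector_derivative_transform_within_open[where S = "{s<..<t}"])
        (use x in \<open>auto simp: p_def\<close>)
    then have "((\<lambda>h. norm (p (x + h) - p x - h *\<^sub>R v x) / norm h) \<longlongrightarrow> 0) (at 0)"
      unfolding has_vector_derivative_def has_derivative_at by simp
    moreover have "filterlim (\<lambda>k. inverse (real (Suc k))) (at 0) sequentially"
      by (intro filterlim_atI LIMSEQ_inverse_real_of_nat) auto
    ultimately have "(\<lambda>k. norm (p (x + inverse (real (Suc k))) - p x - inverse (real (Suc k)) *\<^sub>R v x)
        / norm (inverse (real (Suc k)))) \<longlonglongrightarrow> 0"
      by (rule filterlim_compose)
    moreover have "norm (p (x + inverse (real (Suc k))) - p x - inverse (real (Suc k)) *\<^sub>R v x)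
        / norm (inverse (real (Suc k))) = norm (D k x - v x)" for k
    proof -
      have "D k x - v x =
          real (Suc k) *\<^sub>R (p (x + inverse (real (Suc k))) - p x - inverse (real (Suc k)) *\<^sub>R v x)"
        by (simp add: D_def scaleR_diff_right)
      then show ?thesis
        by (simp add: divide_inverse mult.commute)
    qed
    ultimately have "(\<lambda>k. norm (D k x - v x)) \<longlonglongrightarrow> 0"
      by simp
    then show ?thesis
      by (simp add: tendsto_norm_zero_iff LIM_zero_iff)
  qed
  define E where "E = N \<union> {s, t}"
  have E: "negligible E"
    unfolding E_def using N(1) by (intro negligible_Un) auto
  have "(\<lambda>x. if x \<in> E then 0 else hspeed (v x)) integrable_on {s..t}"
  proof (rule dominated_convergence(1)[where f = "\<lambda>k x. if x \<in> E then 0 else hspeed (D k x)"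
        and h = "\<lambda>_. L"])
    show "(\<lambda>x. if x \<in> E then 0 else hspeed (D k x)) integrable_on {s..t}" for k
    proof (rule integrable_spike[OF _ E])
      show "(\<lambda>x. hspeed (D k x)) integrable_on {s..t}"
        using continuous_on_compose2[OF hspeed_cont D_cont[of k]]
        by (intro integrable_continuous_interval) auto
    qed simp
    show "norm (if x \<in> E then 0 else hspeed (D k x)) \<le> L" for k x
      using order_trans[OF hspeed_le D_le] \<open>0 \<le> L\<close> by (auto simp: hspeed_def)
    show "(\<lambda>k. if x \<in> E then 0 else hspeed (D k x)) \<longlonglongrightarrow> (if x \<in> E then 0 else hspeed (v x))"
      if "x \<in> {s..t}" for x
      using D_lim[of x] that continuous_on_tendsto_compose[OF hspeed_cont, of "\<lambda>k. D k x" "v x"]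
      by (auto simp: E_def)
  qed auto
  then show ?thesis
    by (rule integrable_spike[OF _ E]) (simp add: v)
qed

lemma sr_length_nonneg: "0 \<le> sr_length s t u1 u2"
  unfolding sr_length_def
  by (cases "(\<lambda>x. sqrt ((u1 x)\<^sup>2 + (u2 x)\<^sup>2)) integrable_on {s..t}")
    (simp_all add: integral_nonneg not_integrable_integral)

lemma sr_length_combine:
  assumes "horizontal_G a c q u1 u2" and "a \<le> b" and "b \<le> c"
  shows "sr_length a c u1 u2 = sr_length a b u1 u2 + sr_length b c u1 u2"
  unfolding sr_length_def using assms horizontal_speed_integrable
  by (subst Henstock_Kurzweil_Integration.integral_combine) (auto simp: horizontal_G_def)

lemma sr_length_shift:
  "sr_length (s - c) (t - c) (\<lambda>x. u1 (x + c)) (\<lambda>x. u2 (x + c)) = sr_length s t u1 u2"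
  unfolding sr_length_def
  by (rule integral_shift_real_ivl[of s c t "\<lambda>x. sqrt ((u1 x)\<^sup>2 + (u2 x)\<^sup>2)"])

lemma sr_length_arclength:
  assumes "AE x in lebesgue. 0 \<le> x \<longrightarrow> sqrt ((u1 x)\<^sup>2 + (u2 x)\<^sup>2) = 1" and "0 \<le> t"
  shows "sr_length 0 t u1 u2 = t"
proof -
  obtain N where "negligible N" "\<And>x. x \<notin> N \<Longrightarrow> 0 \<le> x \<longrightarrow> sqrt ((u1 x)\<^sup>2 + (u2 x)\<^sup>2) = 1"
    using assms(1) unfolding eventually_ae_filter_negligible by blast
  then have "sr_length 0 t u1 u2 = integral {0..t} (\<lambda>x. 1)"
    unfolding sr_length_def by (intro integral_spike[of N]) auto
  then show ?thesis
    using assms(2) by simp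
qed

lemma sr_dist_le_length:
  assumes "0 < t" and "hor 0 t q u1 u2" and "q 0 = x" and "q t = y"
  shows "sr_dist hor x y \<le> sr_length 0 t u1 u2"
  unfolding sr_dist_def
proof (rule cInf_lower)
  show "sr_length 0 t u1 u2 \<in>
      {sr_length 0 t u1 u2 | t q u1 u2. 0 < t \<and> hor 0 t q u1 u2 \<and> q 0 = x \<and> q t = y}"
    using assms by blast
  show "bdd_below {sr_length 0 t u1 u2 | t q u1 u2. 0 < t \<and> hor 0 t q u1 u2 \<and> q 0 = x \<and> q t = y}"
    using sr_length_nonneg by (intro bdd_belowI[of _ 0]) auto
qed

text \<open>A connecting curve must be given: over the empty set the infimum would carry no
  information.\<close>

lemma sr_dist_less_obtain:
  assumes "0 < t" and "hor 0 t q u1 u2" and "q 0 = x" and "q t = y" and "sr_dist hor x y < l"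
  obtains r p w1 w2 where "0 < r" and "hor 0 r p w1 w2" and "p 0 = x" and "p r = y"
    and "sr_length 0 r w1 w2 < l"
proof -
  have "{sr_length 0 t u1 u2 | t q u1 u2. 0 < t \<and> hor 0 t q u1 u2 \<and> q 0 = x \<and> q t = y} \<noteq> {}"
    using assms(1-4) by blast
  from cInf_lessD[OF this assms(5)[unfolded sr_dist_def]] show thesis
    using that by blast
qed

section \<open>Minimizers in the group and in the nil-manifold\<close>

lemma length_minimizer_iff:
  assumes "0 < t"
  shows "length_minimizer hor 0 t q \<longleftrightarrow>
    (\<exists>u1 u2. hor 0 t q u1 u2 \<and> sr_length 0 t u1 u2 \<le> sr_dist hor (q 0) (q t))"
  unfolding length_minimizer_def
  using sr_dist_le_length[of t hor q _ _ "q 0" "q t"] assms by (metis order_antisym order_refl)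

text \<open>A shortcut between the ends of an initial arc, followed by the rest of the curve, would be a
  shortcut for the whole curve.\<close>

lemma length_minimizer_G_restrict:
  assumes "length_minimizer horizontal_G 0 T q" and "0 < t" and "t \<le> T"
  shows "length_minimizer horizontal_G 0 t q"
proof -
  obtain u1 u2 where hor: "horizontal_G 0 T q u1 u2"
    and min: "sr_length 0 T u1 u2 = sr_dist horizontal_G (q 0) (q T)"
    using assms(1) unfolding length_minimizer_def by blast
  have hor_t: "horizontal_G 0 t q u1 u2"
    using hor assms(3) unfolding horizontal_G_def by (auto intro: horizontal_on_subset)
  show ?thesis
  proof (rule ccontr)
    assume "\<not> ?thesis"
    then have less: "sr_dist horizontal_G (q 0) (q t) < sr_length 0 t u1 u2"
      using hor_t assms(2) by (auto simp: length_minimizer_iff not_le)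
    obtain r p w1 w2 where r: "0 < r"
      and p: "horizontal_G 0 r p w1 w2" "p 0 = q 0" "p r = q t"
      and short: "sr_length 0 r w1 w2 < sr_length 0 t u1 u2"
      by (rule sr_dist_less_obtain[of t horizontal_G, OF assms(2) hor_t refl refl less])
    \<comment> \<open>The shorter curve \<open>p\<close> on \<open>[0, r]\<close>, followed by the arc of \<open>q\<close> on \<open>[t, T]\<close>.\<close>
    define c where "c = t - r"
    define R where "R = T - c"
    define v1 v2 where "v1 x = (if x \<le> r then w1 x else u1 (x + c))"
      and "v2 x = (if x \<le> r then w2 x else u2 (x + c))" for x
    have rR: "r \<le> R" "t - c = r" "T - c = R" "r + c = t" "R + c = T"
      using assms(3) by (auto simp: c_def R_def)
    have "horizontal_on {t..T} q u1 u2"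
      using hor assms(2) unfolding horizontal_G_def by (auto intro: horizontal_on_subset)
    from horizontal_on_shift[OF this, of c]
    have "horizontal_on {r..R} (\<lambda>x. q (x + c)) (\<lambda>x. u1 (x + c)) (\<lambda>x. u2 (x + c))"
      by (simp add: rR)
    with p have glue: "horizontal_G 0 R (\<lambda>x. if x \<le> r then p x else q (x + c)) v1 v2"
      unfolding horizontal_G_def v1_def v2_def by (intro horizontal_on_glue) (simp_all add: rR)
    have "(if R \<le> r then p R else q (R + c)) = q T"
      using rR p(3) by (cases "R = r") auto
    then have "sr_dist horizontal_G (q 0) (q T) \<le> sr_length 0 R v1 v2"
      using sr_dist_le_length[of R horizontal_G, OF _ glue refl refl] r rR(1) p(2) by simp
    also have "\<dots> = sr_length 0 r v1 v2 + sr_length r R v1 v2"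
      using glue r rR by (intro sr_length_combine) auto
    also have "sr_length 0 r v1 v2 = sr_length 0 r w1 w2"
      unfolding sr_length_def by (intro integral_cong) (auto simp: v1_def v2_def)
    also have "sr_length r R v1 v2 = sr_length r R (\<lambda>x. u1 (x + c)) (\<lambda>x. u2 (x + c))"
      unfolding sr_length_def by (rule integral_spike[of "{r}"]) (auto simp: v1_def v2_def)
    also have "\<dots> = sr_length t T u1 u2"
      using sr_length_shift[of t c T] by (simp add: rR)
    also have "sr_length 0 r w1 w2 + sr_length t T u1 u2 < sr_length 0 T u1 u2"
      using short sr_length_combine[OF hor, of t] assms by simp
    finally show False
      using min by simp
  qed
qed

text \<open>A shortcut for \<open>g\<close> would project to a shortcut of the same length for its projection.\<close>

lemma length_minimizer_G_of_projection:
  assumes "continuous_on {0..t} g" and "0 < t" and "length_minimizer horizontal_M 0 t (nil_proj \<circ> g)"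
  shows "length_minimizer horizontal_G 0 t g"
proof -
  obtain u1 u2 where M: "horizontal_M 0 t (nil_proj \<circ> g) u1 u2"
    and min: "sr_length 0 t u1 u2 = sr_dist horizontal_M (nil_proj (g 0)) (nil_proj (g t))"
    using assms(3) unfolding length_minimizer_def by auto
  have G: "horizontal_G 0 t g u1 u2"
    using horizontal_G_of_projection[OF assms(1) M] assms(2) by simp
  have "sr_length 0 t u1 u2 \<le> sr_dist horizontal_G (g 0) (g t)"
  proof (rule ccontr)
    assume "\<not> ?thesis"
    then have less: "sr_dist horizontal_G (g 0) (g t) < sr_length 0 t u1 u2"
      by simp
    obtain r p w1 w2 where p: "0 < r" "horizontal_G 0 r p w1 w2" "p 0 = g 0" "p r = g t"
      "sr_length 0 r w1 w2 < sr_length 0 t u1 u2"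
      by (rule sr_dist_less_obtain[of t horizontal_G, OF assms(2) G refl refl less])
    then have "sr_dist horizontal_M (nil_proj (g 0)) (nil_proj (g t)) \<le> sr_length 0 r w1 w2"
      using horizontal_M_projection[OF p(2)] by (intro sr_dist_le_length[of r horizontal_M "nil_proj \<circ> p"]) auto
    with p(5) min show False
      by simp
  qed
  with G assms(2) show ?thesis
    by (auto simp: length_minimizer_iff)
qed

text \<open>Lift a curve shorter than the projection of \<open>g\<close> to start at the identity. It ends at
  \<open>h \<otimes> g t\<close> for an integer point \<open>h\<close>. If \<open>h\<close> is the identity, the lift is a shortcut for \<open>g\<close>.
  Otherwise its endpoint lies in the ball around the identity, because the lift is short, and in
  the ball around \<open>h\<close>, because the translate of \<open>g\<close> by \<open>h\<close> joins \<open>h\<close> to it; but these balls are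
  disjoint.\<close>

lemma length_minimizer_projection:
  assumes "length_minimizer horizontal_G 0 t g" and "0 < t" and "g 0 = \<one>\<^bsub>heis\<^esub>"
    and dist: "sr_dist horizontal_G (g 0) (g t) \<le> T"
    and disjoint: "\<And>h1 h2. h1 \<in> heis_int \<Longrightarrow> h2 \<in> heis_int \<Longrightarrow> h1 \<noteq> h2 \<Longrightarrow>
      sr_ball T h1 \<inter> sr_ball T h2 = {}"
  shows "length_minimizer horizontal_M 0 t (nil_proj \<circ> g)"
proof -
  obtain u1 u2 where G: "horizontal_G 0 t g u1 u2"
    and min: "sr_length 0 t u1 u2 = sr_dist horizontal_G (g 0) (g t)"
    using assms(1) unfolding length_minimizer_def by auto
  have M: "horizontal_M 0 t (nil_proj \<circ> g) u1 u2"
    using G by (rule horizontal_M_projection)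
  have "sr_length 0 t u1 u2 \<le> sr_dist horizontal_M ((nil_proj \<circ> g) 0) ((nil_proj \<circ> g) t)"
  proof (rule ccontr)
    assume "\<not> ?thesis"
    then have less: "sr_dist horizontal_M ((nil_proj \<circ> g) 0) ((nil_proj \<circ> g) t) < sr_length 0 t u1 u2"
      by simp
    obtain r p w1 w2 where r: "0 < r" and p: "horizontal_M 0 r p w1 w2"
      "p 0 = (nil_proj \<circ> g) 0" "p r = (nil_proj \<circ> g) t"
      and short: "sr_length 0 r w1 w2 < sr_length 0 t u1 u2"
      by (rule sr_dist_less_obtain[of t horizontal_M, OF assms(2) M refl refl less])
    have "nil_proj (g 0) = p 0"
      by (simp add: p(2))
    then obtain P where P: "horizontal_G 0 r P w1 w2" "P 0 = g 0"
      "\<And>x. x \<in> {0..r} \<Longrightarrow> nil_proj (P x) = p x"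
      by (rule horizontal_M_lift[OF p(1) less_imp_le[OF r]]) blast
    have "nil_proj (g t) = nil_proj (P r)"
      using P(3)[of r] p(3) r by simp
    then obtain h where h: "h \<in> heis_int" "P r = h \<otimes>\<^bsub>heis\<^esub> g t"
      unfolding nil_proj_eq_iff by blast
    have P_short: "sr_dist horizontal_G (g 0) (P r) < sr_length 0 t u1 u2"
      using sr_dist_le_length[of r horizontal_G, OF r P(1,2) refl] short by simp
    have "h \<noteq> \<one>\<^bsub>heis\<^esub>"
      using P_short h(2) min by auto
    have "P r \<in> sr_ball T \<one>\<^bsub>heis\<^esub>"
      using P_short min dist assms(3) by (simp add: sr_ball_def)
    moreover have "P r \<in> sr_ball T h"
    proof -
      have "horizontal_G 0 t (\<lambda>x. h \<otimes>\<^bsub>heis\<^esub> g x) u1 u2"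
        using G unfolding horizontal_G_def by (rule horizontal_on_translate)
      then have "sr_dist horizontal_G h (P r) \<le> sr_length 0 t u1 u2"
        using assms(3) h(2)
          sr_dist_le_length[of t horizontal_G "\<lambda>x. h \<otimes>\<^bsub>heis\<^esub> g x" u1 u2 h "P r"]
        by (simp add: assms(2))
      then show ?thesis
        using min dist by (simp add: sr_ball_def)
    qed
    ultimately show False
      using disjoint[OF heis_one_int h(1)] \<open>h \<noteq> \<one>\<^bsub>heis\<^esub>\<close> by auto
  qed
  with M assms(2) show ?thesis
    by (auto simp: length_minimizer_iff)
qed

section \<open>Cut times\<close>

text \<open>By itself the supremum only yields minimizing arcs on intervals longer than \<open>t\<close>; these are
  then restricted.\<close>

lemma less_t_cut_G_imp_minimizer:
  assumes "ereal t < t_cut horizontal_G g" and "0 < t"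
  shows "length_minimizer horizontal_G 0 t g"
proof -
  obtain T where "length_minimizer horizontal_G 0 T g" "t \<le> T"
    using assms(1) unfolding t_cut_def less_Sup_iff by auto
  with assms(2) show ?thesis
    by (auto intro: length_minimizer_G_restrict)
qed

lemma le_t_cut: "0 < t \<Longrightarrow> length_minimizer hor 0 t q \<Longrightarrow> ereal t \<le> t_cut hor q"
  unfolding t_cut_def by (intro Sup_upper) auto

theorem corollary10p5:
  fixes g :: "real \<Rightarrow> heis_point"
  assumes "arclength_geodesic horizontal_G g"
    and "g 0 = \<one>\<^bsub>heis\<^esub>"
  shows "t_cut horizontal_M (nil_proj \<circ> g) \<le> t_cut horizontal_G g \<and>
    (t_hat \<le> t_cut horizontal_G g \<longrightarrow>
       t_hat \<le> t_cut horizontal_M (nil_proj \<circ> g) \<and>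
       t_cut horizontal_M (nil_proj \<circ> g) \<le> t_cut horizontal_G g) \<and>
    (t_cut horizontal_G g < t_hat \<longrightarrow>
       t_cut horizontal_M (nil_proj \<circ> g) = t_cut horizontal_G g)"
proof -
  let ?G = "t_cut horizontal_G g" and ?M = "t_cut horizontal_M (nil_proj \<circ> g)"
  obtain u1 u2 where hor: "\<And>t. 0 < t \<Longrightarrow> horizontal_G 0 t g u1 u2"
    and arc: "AE x in lebesgue. 0 \<le> x \<longrightarrow> sqrt ((u1 x)\<^sup>2 + (u2 x)\<^sup>2) = 1"
    using assms(1) unfolding arclength_geodesic_def by auto
  have cont: "continuous_on {0..t} g" if "0 < t" for t
    using hor[OF that] by (auto simp: horizontal_G_def intro: horizontal_on_continuous_on)
  have dist: "sr_dist horizontal_G (g 0) (g t) \<le> t" if "0 < t" for t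
    using sr_dist_le_length[of t horizontal_G, OF that hor[OF that] refl refl] sr_length_arclength[OF arc, of t] that
    by simp
  have le: "?M \<le> ?G"
  proof (subst t_cut_def, rule Sup_least, clarify)
    fix t assume t: "0 < t" "length_minimizer horizontal_M 0 t (nil_proj \<circ> g)"
    then show "ereal t \<le> ?G"
      using length_minimizer_G_of_projection[OF cont] by (auto intro: le_t_cut)
  qed
  have min: "length_minimizer horizontal_M 0 t (nil_proj \<circ> g)"
    if t: "0 < t" "length_minimizer horizontal_G 0 t g" "ereal t < t_hat" for t
  proof -
    obtain T where T: "t < T" "\<And>h1 h2. h1 \<in> heis_int \<Longrightarrow> h2 \<in> heis_int \<Longrightarrow> h1 \<noteq> h2 \<Longrightarrow>
        sr_ball T h1 \<inter> sr_ball T h2 = {}"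
      using t(3) unfolding t_hat_def less_Sup_iff by auto
    show ?thesis
      by (rule length_minimizer_projection[OF t(2,1) assms(2) _ T(2)]) (use dist[OF t(1)] T(1) in auto)
  qed
  have "t_hat \<le> ?M" if "t_hat \<le> ?G"
  proof (cases "t_hat \<le> 0")
    case True
    \<comment> \<open>A supremum of positive numbers that is not positive is the supremum of the empty set.\<close>
    then have "t_hat = -\<infinity>"
      unfolding t_hat_def Sup_le_iff by (auto intro!: Sup_eqI)
    then show ?thesis
      by (metis ereal_less_eq(2))
  next
    case False
    then have "0 < t_hat" by simp
    then show ?thesis
    proof (rule dense_le_bounded)
      fix w assume w: "0 < w" "w < t_hat"
      then obtain t where t: "w = ereal t" "0 < t"
        by (cases w) auto
      have "length_minimizer horizontal_G 0 t g"
        using w that t by (intro less_t_cut_G_imp_minimizer) auto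
      with min t w show "w \<le> ?M"
        by (auto intro: le_t_cut)
    qed
  qed
  moreover have "?M = ?G" if less: "?G < t_hat"
  proof (rule antisym[OF le])
    show "?G \<le> ?M"
    proof (subst t_cut_def, rule Sup_least, clarify)
      fix t assume t: "0 < t" "length_minimizer horizontal_G 0 t g"
      then have "ereal t < t_hat"
        using le_t_cut less by (metis order_le_less_trans)
      with min t show "ereal t \<le> ?M"
        by (auto intro: le_t_cut)
    qed
  qed
  ultimately show ?thesis
    using le by blast
qed

end
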